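(* For every $n$ there exist a field $\mathbb{F}$ and subsets $\mathcal{S}_1,\dots,\mathcal{S}_n\subseteq\mathbb{F}$, each of size $3$, such that the family of degree-$1$ functions $f:\mathcal{S}_1\times\cdots\times\mathcal{S}_n\to\mathbb{F}$ is not locally testable: the minimal number of queries of a tester for this family is not bounded by any constant independent of $n$ (it is $\omega_n(1)$).
   Context: A function $f:\mathcal{S}_1\times\cdots\times\mathcal{S}_n\to\mathbb{F}$ is degree-$1$ if there is a polynomial in $\mathbb{F}[x_1,\dots,x_n]$ of total degree at most $1$ agreeing with $f$ on the whole grid. For a family $\mathcal{F}$, $\delta_{\mathcal{F}}(f)$ is the minimum over $g\in\mathcal{F}$ of the fraction of grid points where $f,g$ differ. $\mathcal{F}$ is $q$-locally testable if there is a randomized algorithm making at most $q$ oracle queries to $f$ that accepts with probability $1$ when $f\in\mathcal{F}$ and rejects with probability at least $\delta_{\mathcal{F}}(f)/2$ when $f\notin\mathcal{F}$; it is locally testable if this holds with $q=O(1)$ independent of $n$. *)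

theory Defs
  imports
    "HOL-Algebra.Indexed_Polynomials"
    "HOL-Probability.Probability_Measure"
    "HOL-Library.Landau_Symbols"
begin

section \<open>Low-degree functions on grids\<close>

definition grid :: "nat \<Rightarrow> (nat \<Rightarrow> 'a set) \<Rightarrow> (nat \<Rightarrow> 'a) set" where
  "grid n S = (\<Pi>\<^sub>E i\<in>{1..n}. S i)"

text \<open>
  A polynomial of \<open>HOL-Algebra.Indexed_Polynomials\<close> maps a monomial, given as the
  multiset of its variables, to its coefficient. That theory provides neither evaluation
  at a point nor total degree.
\<close>

definition mpoly_eval :: "('a, 'b) ring_scheme \<Rightarrow> (nat multiset \<Rightarrow> 'a) \<Rightarrow> (nat \<Rightarrow> 'a) \<Rightarrow> 'a" where
  "mpoly_eval R P x =
     (\<Oplus>\<^bsub>R\<^esub>m\<in>{m. P m \<noteq> \<zero>\<^bsub>R\<^esub>}. P m \<otimes>\<^bsub>R\<^esub> (\<Otimes>\<^bsub>R\<^esub>i\<in>set_mset m. x i [^]\<^bsub>R\<^esub> count m i))"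

definition total_degree_le :: "('a, 'b) ring_scheme \<Rightarrow> (nat multiset \<Rightarrow> 'a) \<Rightarrow> nat \<Rightarrow> bool" where
  "total_degree_le R P d \<longleftrightarrow> (\<forall>m. P m \<noteq> \<zero>\<^bsub>R\<^esub> \<longrightarrow> size m \<le> d)"

definition degree_family ::
  "('a, 'b) ring_scheme \<Rightarrow> nat \<Rightarrow> (nat \<Rightarrow> 'a set) \<Rightarrow> nat \<Rightarrow> ((nat \<Rightarrow> 'a) \<Rightarrow> 'a) set" where
  "degree_family R n S d =
     {f \<in> grid n S \<rightarrow>\<^sub>E carrier R.
        \<exists>P \<in> ring.indexed_pset R {1..n} (carrier R).
          total_degree_le R P d \<and> (\<forall>x\<in>grid n S. f x = mpoly_eval R P x)}"

section \<open>Local testability\<close>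

text \<open>
  In this section a property is a family \<open>\<F>\<close> of functions from a finite nonempty set \<open>D\<close>
  to an alphabet \<open>A\<close>, represented extensionally, that is, \<open>\<F> \<subseteq> D \<rightarrow>\<^sub>E A\<close>.
\<close>

definition distance_to :: "'x set \<Rightarrow> ('x \<Rightarrow> 'a) set \<Rightarrow> ('x \<Rightarrow> 'a) \<Rightarrow> real" where
  "distance_to D \<F> f = Min ((\<lambda>g. real (card {x\<in>D. f x \<noteq> g x}) / real (card D)) ` \<F>)"

text \<open>
  A deterministic oracle algorithm is a decision tree: it either halts, accepting or
  rejecting, or queries the oracle at a point and continues according to the answer.
  Queries may therefore be adaptive.
\<close>

datatype ('x, 'a) oracle_alg = Halt bool | Query 'x "'a \<Rightarrow> ('x, 'a) oracle_alg"

primrec accepts :: "('x, 'a) oracle_alg \<Rightarrow> ('x \<Rightarrow> 'a) \<Rightarrow> bool" where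
  "accepts (Halt b) f = b"
| "accepts (Query x k) f = accepts (k (f x)) f"

primrec queries :: "('x, 'a) oracle_alg \<Rightarrow> ('x \<Rightarrow> 'a) \<Rightarrow> 'x list" where
  "queries (Halt b) f = []"
| "queries (Query x k) f = x # queries (k (f x)) f"

text \<open>
  A randomized oracle algorithm is a probability measure on deterministic ones (all coins
  are tossed in advance). The \<open>\<sigma>\<close>-algebra is arbitrary, apart from making the acceptance
  events measurable, so the randomness need not be discrete.
\<close>

definition is_tester ::
  "nat \<Rightarrow> 'x set \<Rightarrow> 'a set \<Rightarrow> ('x \<Rightarrow> 'a) set \<Rightarrow> ('x, 'a) oracle_alg measure \<Rightarrow> bool" where
  "is_tester q D A \<F> M \<longleftrightarrow>
     prob_space M \<and>
     (\<forall>T\<in>space M. \<forall>f\<in>D \<rightarrow>\<^sub>E A. set (queries T f) \<subseteq> D \<and> length (queries T f) \<le> q) \<and>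
     (\<forall>f\<in>D \<rightarrow>\<^sub>E A. {T\<in>space M. accepts T f} \<in> sets M) \<and>
     (\<forall>f\<in>\<F>. measure M {T\<in>space M. accepts T f} = 1) \<and>
     (\<forall>f\<in>(D \<rightarrow>\<^sub>E A) - \<F>. measure M {T\<in>space M. \<not> accepts T f} \<ge> distance_to D \<F> f / 2)"

definition q_locally_testable :: "nat \<Rightarrow> 'x set \<Rightarrow> 'a set \<Rightarrow> ('x \<Rightarrow> 'a) set \<Rightarrow> bool" where
  "q_locally_testable q D A \<F> \<longleftrightarrow> (\<exists>M. is_tester q D A \<F> M)"

text \<open>The minimum exists: reading all of \<open>D\<close> gives a tester with \<open>card D\<close> queries.\<close>

definition query_complexity :: "'x set \<Rightarrow> 'a set \<Rightarrow> ('x \<Rightarrow> 'a) set \<Rightarrow> nat" where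
  "query_complexity D A \<F> = (LEAST q. q_locally_testable q D A \<F>)"

definition locally_testable ::
  "(nat \<Rightarrow> 'x set) \<Rightarrow> (nat \<Rightarrow> 'a set) \<Rightarrow> (nat \<Rightarrow> ('x \<Rightarrow> 'a) set) \<Rightarrow> bool" where
  "locally_testable D A \<F> \<longleftrightarrow> (\<exists>q. \<forall>n. q_locally_testable q (D n) (A n) (\<F> n))"

end

theory Submission
  imports Defs "HOL-Probability.Giry_Monad" "HOL-Number_Theory.Residues"
begin

text \<open>
  On the grid with sides \<open>{0, 1, a\<^sub>i}\<close>, where the \<open>a\<^sub>i\<close> are pairwise distinct, the indicator function
  \<open>f\<^sub>i\<close> of \<open>x\<^sub>i = a\<^sub>i\<close> disagrees with each function of degree 1 on every line in direction \<open>i\<close>, hence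
  on at least a third of the grid. So a tester rejects each \<open>f\<^sub>i\<close> with probability at least \<open>1/6\<close>.
  On the other hand, let a decision tree accept all functions of degree 1, and call two coordinates
  \<open>i \<noteq> j\<close> alike on the queried points if these take the values \<open>0\<close>, \<open>1\<close> and \<open>a\<^sub>i\<close> in coordinate \<open>i\<close>
  where they take \<open>0\<close>, \<open>1\<close> and \<open>a\<^sub>j\<close> in coordinate \<open>j\<close>. Then \<open>f\<^sub>i\<close> agrees with
  \<open>(x\<^sub>i - x\<^sub>j) / (a\<^sub>i - a\<^sub>j)\<close> on the queries, so the tree cannot reject it. Therefore the tree rejects at
  most as many of the \<open>f\<^sub>i\<close> as there are ternary words of length at most \<open>q\<close>, a number that does not
  depend on \<open>n\<close>, and averaging over the tester bounds \<open>n\<close> in terms of \<open>q\<close>.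
\<close>

section \<open>Testers\<close>

lemma queries_accepts_cong:
  assumes "\<And>x. x \<in> set (queries T f) \<Longrightarrow> f x = g x"
  shows "queries T g = queries T f" and "accepts T g = accepts T f"
  using assms by (induction T) auto

text \<open>Every answer is \<open>d\<close> of a colour, and the answers so far determine the next
  query. So two oracles whose runs show the same colour word follow the same path through the tree,
  even under different colourings \<open>p\<close> and \<open>p'\<close>.\<close>

lemma queries_eqI:
  assumes "map p (queries T f) = map p' (queries T g)"
    and "\<And>x. x \<in> set (queries T f) \<Longrightarrow> f x = d (p x)"
    and "\<And>x. x \<in> set (queries T g) \<Longrightarrow> g x = d (p' x)"
  shows "queries T f = queries T g"
  using assms
proof (induction T)
  case (Query x k)
  have "f x = d (p x)" "g x = d (p' x)"
    using Query.prems(2)[of x] Query.prems(3)[of x] by simp_all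
  moreover have "p x = p' x"
    using Query.prems(1) by simp
  ultimately have fg: "g x = f x"
    by metis
  have "queries (k (f x)) f = queries (k (f x)) g"
  proof (rule Query.IH)
    show "map p (queries (k (f x)) f) = map p' (queries (k (f x)) g)"
      using Query.prems(1) by (simp add: fg)
    show "f y = d (p y)" if "y \<in> set (queries (k (f x)) f)" for y
      using Query.prems(2)[of y] that by simp
    show "g y = d (p' y)" if "y \<in> set (queries (k (f x)) g)" for y
      using Query.prems(3)[of y] that by (simp add: fg)
  qed simp
  with fg show ?case
    by simp
qed simp

section \<open>The tester that reads the whole oracle\<close>

lemma distance_to_le_1:
  assumes "finite D" "D \<noteq> {}" "finite \<F>" "\<F> \<noteq> {}"
  shows "distance_to D \<F> f \<le> 1"
proof -
  obtain g where g: "g \<in> \<F>"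
    using assms by auto
  have "distance_to D \<F> f \<le> real (card {x\<in>D. f x \<noteq> g x}) / real (card D)"
    unfolding distance_to_def using assms g by (intro Min_le) auto
  also have "\<dots> \<le> 1"
    using assms by (simp add: divide_le_eq card_gt_0_iff card_mono)
  finally show ?thesis .
qed

primrec read_all :: "'x list \<Rightarrow> (('x \<Rightarrow> 'a) \<Rightarrow> bool) \<Rightarrow> ('x \<Rightarrow> 'a) \<Rightarrow> ('x, 'a) oracle_alg" where
  "read_all [] P h = Halt (P h)"
| "read_all (x # xs) P h = Query x (\<lambda>a. read_all xs P (h(x := a)))"

lemma queries_read_all [simp]: "queries (read_all xs P h) f = xs"
  by (induction xs arbitrary: h) auto

lemma accepts_read_all: "accepts (read_all xs P h) f = P (\<lambda>x. if x \<in> set xs then f x else h x)"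
  by (induction xs arbitrary: h) (auto intro!: arg_cong[where f = P])

text \<open>This supplies a member of the set that the \<open>LEAST\<close> in
  \<open>query_complexity\<close> minimizes over. Certain rejection suffices because distances are
  at most 1.\<close>

lemma q_locally_testable_card:
  assumes D: "finite D" "D \<noteq> {}" and \<F>: "finite \<F>" "\<F> \<noteq> {}" "\<F> \<subseteq> D \<rightarrow>\<^sub>E A"
  shows "q_locally_testable (card D) D A \<F>"
proof -
  obtain xs where xs: "set xs = D" "distinct xs"
    using D finite_distinct_list by blast
  \<comment> \<open>The table starts as \<open>undefined\<close>, the value of every function in
    \<open>D \<rightarrow>\<^sub>E A\<close> outside \<open>D\<close>; after reading all of
    \<open>D\<close> it is therefore \<open>f\<close> itself.\<close>
  define T where "T = read_all xs (\<lambda>f. f \<in> \<F>) (\<lambda>_. undefined)"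
  have acc: "accepts T f \<longleftrightarrow> f \<in> \<F>" if "f \<in> D \<rightarrow>\<^sub>E A" for f
  proof -
    have "(\<lambda>x. if x \<in> D then f x else undefined) = f"
      using that by (auto simp: PiE_def extensional_def)
    then show ?thesis
      by (simp add: T_def accepts_read_all xs)
  qed
  define M where "M = return (count_space {T}) T"
  have space: "space M = {T}" and sets: "sets M = Pow {T}"
    by (simp_all add: M_def)
  have meas: "measure M {U\<in>space M. Q U} = (if Q T then 1 else 0)" for Q
    unfolding space unfolding M_def by (subst measure_return) (auto simp: indicator_def)
  have "is_tester (card D) D A \<F> M"
    unfolding is_tester_def
  proof (intro conjI ballI)
    show "prob_space M"
      unfolding M_def by (intro prob_space_return) simp
    show "{U \<in> space M. accepts U f} \<in> sets M" for f
      by (auto simp: space sets)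
    show "measure M {U\<in>space M. accepts U f} = 1" if "f \<in> \<F>" for f
      using that \<F> acc[of f] by (auto simp: meas)
    show "distance_to D \<F> f / 2 \<le> measure M {U\<in>space M. \<not> accepts U f}"
      if "f \<in> (D \<rightarrow>\<^sub>E A) - \<F>" for f
      using that acc[of f] distance_to_le_1[OF D \<F>(1,2), of f] by (auto simp: meas)
    show "set (queries U f) \<subseteq> D" "length (queries U f) \<le> card D" if "U \<in> space M" for U f
      using that xs distinct_card[of xs] by (auto simp: space T_def)
  qed
  then show ?thesis
    unfolding q_locally_testable_def by blast
qed

section \<open>Counting the functions that a tester rejects\<close>

text \<open>
  In the application, the colour \<open>p i x\<close> records which of the three values \<open>x\<close> takes in
  coordinate \<open>i\<close>.
\<close>

lemma card_rejected_le:
  assumes T: "\<And>g. g \<in> \<F> \<Longrightarrow> accepts T g"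
    and C: "finite C" and p: "\<And>i x. i \<in> I \<Longrightarrow> x \<in> D \<Longrightarrow> p i x \<in> C \<and> f i x = d (p i x)"
    and q: "\<And>i. i \<in> I \<Longrightarrow> set (queries T (f i)) \<subseteq> D \<and> length (queries T (f i)) \<le> q"
    and g: "\<And>i j. i \<in> I \<Longrightarrow> j \<in> I \<Longrightarrow> i \<noteq> j \<Longrightarrow> \<exists>g\<in>\<F>. \<forall>x\<in>D. p i x = p j x \<longrightarrow> g x = f i x"
  shows "card {i\<in>I. \<not> accepts T (f i)} \<le> (\<Sum>k\<le>q. card C ^ k)"
proof -
  have colours: "set (map (p i) (queries T (f i))) \<subseteq> C" if "i \<in> I" for i
    using q[OF that] p[OF that] by (fastforce simp: subset_iff)
  \<comment> \<open>The colour word read along its run identifies a rejected index, and there are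
    only boundedly many words of length at most \<open>q\<close>.\<close>
  have "inj_on (\<lambda>i. map (p i) (queries T (f i))) {i\<in>I. \<not> accepts T (f i)}"
  proof (rule inj_onI, rule ccontr)
    fix i j
    assume i: "i \<in> {i\<in>I. \<not> accepts T (f i)}" and j: "j \<in> {i\<in>I. \<not> accepts T (f i)}"
      and eq: "map (p i) (queries T (f i)) = map (p j) (queries T (f j))" and "i \<noteq> j"
    have Q: "queries T (f i) = queries T (f j)"
      using eq p q i j by (intro queries_eqI[where d = d]) blast+
    \<comment> \<open>This \<open>h\<close> agrees with \<open>f i\<close> along the common run, so
      a tree accepting \<open>h\<close> cannot reject \<open>f i\<close>.\<close>
    obtain h where h: "h \<in> \<F>" "\<And>x. x \<in> D \<Longrightarrow> p i x = p j x \<Longrightarrow> h x = f i x"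
      using g[of i j] i j \<open>i \<noteq> j\<close> by blast
    have "accepts T h = accepts T (f i)"
    proof (rule queries_accepts_cong(2))
      fix x assume x: "x \<in> set (queries T (f i))"
      with eq have "p i x = p j x"
        unfolding Q by simp
      with x show "f i x = h x"
        using h(2)[of x] q[of i] i by auto
    qed
    with T[OF h(1)] i show False
      by simp
  qed
  then have "card {i\<in>I. \<not> accepts T (f i)} \<le> card {xs. set xs \<subseteq> C \<and> length xs \<le> q}"
    by (rule card_inj_on_le) (use colours q C in \<open>simp_all add: image_subset_iff finite_lists_length_le\<close>)
  then show ?thesis
    by (simp add: C card_lists_length_le)
qed

text \<open>By linearity, the sum is the expected number of rejected \<open>f i\<close>; the count
  for a single tree bounds that number almost surely.\<close>

lemma sum_rejection_probability_le:
  assumes M: "is_tester q D A \<F> M" and \<F>: "finite \<F>" "\<F> \<subseteq> D \<rightarrow>\<^sub>E A"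
    and I: "finite I" and f: "\<And>i. i \<in> I \<Longrightarrow> f i \<in> D \<rightarrow>\<^sub>E A"
    and C: "finite C" and p: "\<And>i x. i \<in> I \<Longrightarrow> x \<in> D \<Longrightarrow> p i x \<in> C \<and> f i x = d (p i x)"
    and g: "\<And>i j. i \<in> I \<Longrightarrow> j \<in> I \<Longrightarrow> i \<noteq> j \<Longrightarrow> \<exists>g\<in>\<F>. \<forall>x\<in>D. p i x = p j x \<longrightarrow> g x = f i x"
  shows "(\<Sum>i\<in>I. measure M {T\<in>space M. \<not> accepts T (f i)}) \<le> real (\<Sum>k\<le>q. card C ^ k)"
proof -
  interpret prob_space M
    using M by (simp add: is_tester_def)
  define E where "E i = {T\<in>space M. \<not> accepts T (f i)}" for i
  have E: "E i \<in> events" if "i \<in> I" for i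
  proof -
    have "{T\<in>space M. accepts T (f i)} \<in> events"
      using M f[OF that] by (simp add: is_tester_def)
    moreover have "E i = space M - {T\<in>space M. accepts T (f i)}"
      by (auto simp: E_def)
    ultimately show ?thesis
      by simp
  qed
  have "AE T in M. accepts T g" if "g \<in> \<F>" for g
  proof -
    have "prob {T\<in>space M. accepts T g} = 1"
      using M that by (simp add: is_tester_def)
    from AE_prob_1[OF this] show ?thesis
      by simp
  qed
  \<comment> \<open>The count concerns a tree that accepts all of \<open>\<F>\<close> at once. As
    \<open>\<F>\<close> is finite, the null sets for its members have a null union.\<close>
  then have AE: "AE T in M. \<forall>g\<in>\<F>. accepts T g"
    using \<F> by (intro AE_finite_allI)
  have "(\<Sum>i\<in>I. prob (E i)) = (\<Sum>i\<in>I. expectation (indicator (E i)))"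
    using E by simp
  also have "\<dots> = expectation (\<lambda>T. \<Sum>i\<in>I. indicator (E i) T)"
    using E by (intro Bochner_Integration.integral_sum[symmetric])
      (simp add: integrable_indicator_iff emeasure_eq_measure)
  also have "\<dots> \<le> real (\<Sum>k\<le>q. card C ^ k)"
  proof (rule integral_le_const)
    show "integrable M (\<lambda>T. \<Sum>i\<in>I. indicator (E i) T :: real)"
      using E by (intro Bochner_Integration.integrable_sum)
        (simp add: integrable_indicator_iff emeasure_eq_measure)
    show "AE T in M. (\<Sum>i\<in>I. indicator (E i) T) \<le> real (\<Sum>k\<le>q. card C ^ k)"
      using AE AE_space
    proof eventually_elim
      case (elim T)
      have "(\<Sum>i\<in>I. indicator (E i) T) = real (card {i\<in>I. \<not> accepts T (f i)})"
        using I elim by (simp add: indicator_def E_def sum.If_cases Int_def conj_commute)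
      also have "card {i\<in>I. \<not> accepts T (f i)} \<le> (\<Sum>k\<le>q. card C ^ k)"
      proof (rule card_rejected_le[where \<F> = \<F> and D = D and p = p and d = d])
        show "set (queries T (f i)) \<subseteq> D \<and> length (queries T (f i)) \<le> q" if "i \<in> I" for i
          using M f[OF that] elim by (simp add: is_tester_def)
      qed (use elim C p g in auto)
      finally show ?case
        by simp
    qed
  qed
  finally show ?thesis
    unfolding E_def .
qed

section \<open>Functions of degree one\<close>

context cring
begin

lemma indexed_pset_support:
  assumes "P \<in> indexed_pset I K" "P m \<noteq> \<zero>"
  shows "set_mset m \<subseteq> I"
  using assms
proof (induction arbitrary: m)
  case (indexed_const k)
  then show ?case
    by (auto simp: indexed_const_def split: if_splits)
next
  case (indexed_padd P Q)
  then show ?case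
    by (cases "P m = \<zero>"; cases "Q m = \<zero>") (auto simp: indexed_padd_def)
next
  case (indexed_pmult P i)
  from indexed_pmult.prems have "i \<in># m" "P (m - {#i#}) \<noteq> \<zero>"
    by (auto simp: indexed_pmult_def split: if_splits)
  with indexed_pmult.IH[of "m - {#i#}"] indexed_pmult.hyps show ?case
    by (metis insert_DiffM insert_subset set_mset_add_mset_insert)
qed

text \<open>Monomials of size at most 1 are empty or a single variable. Enlarging the support to the
  fixed set \<open>B\<close> of all of these adds only zero terms.\<close>

lemma mpoly_eval_degree_1:
  assumes P: "P \<in> indexed_pset I (carrier R)" "total_degree_le R P 1"
    and I: "finite I" and x: "x \<in> I \<rightarrow> carrier R"
  shows "mpoly_eval R P x = P {#} \<oplus> (\<Oplus>i\<in>I. P {#i#} \<otimes> x i)"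
proof -
  have P_closed [simp]: "P m \<in> carrier R" for m
    using indexed_pset_in_carrier[OF subset_refl P(1)] by (rule carrier_coeffE)
  define h where "h m = P m \<otimes> (\<Otimes>i\<in>set_mset m. x i [^] count m i)" for m
  define B where "B = insert {#} ((\<lambda>i. {#i#}) ` I)"
  have supp: "{m. P m \<noteq> \<zero>} \<subseteq> B"
  proof
    fix m assume m: "m \<in> {m. P m \<noteq> \<zero>}"
    then have "set_mset m \<subseteq> I"
      using indexed_pset_support[OF P(1)] by simp
    moreover have "size m \<le> 1"
      using m P(2) by (simp add: total_degree_le_def)
    then have "m = {#} \<or> (\<exists>i. m = {#i#})"
      by (metis One_nat_def le_Suc_eq le_zero_eq size_eq_0_iff_empty size_1_singleton_mset)
    ultimately show "m \<in> B"
      by (auto simp: B_def)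
  qed
  have h0: "h {#} = P {#}"
    by (simp add: h_def)
  have h1: "h {#i#} = P {#i#} \<otimes> x i" if "i \<in> I" for i
  proof -
    have "x i \<in> carrier R"
      using x that by auto
    then show ?thesis
      by (simp add: h_def)
  qed
  have hB: "h \<in> B \<rightarrow> carrier R"
    using x by (auto simp: B_def h0 h1 Pi_def)
  have "mpoly_eval R P x = (\<Oplus>m\<in>{m. P m \<noteq> \<zero>}. h m)"
    by (simp add: mpoly_eval_def h_def)
  also have "\<dots> = (\<Oplus>m\<in>B. h m)"
  proof (rule add.finprod_mono_neutral_cong_left)
    fix m assume m: "m \<in> B - {m. P m \<noteq> \<zero>}"
    then show "h m = \<zero>"
      using x by (auto simp: B_def h0 h1 Pi_def)
  qed (use supp I hB in \<open>auto simp: B_def\<close>)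
  also have "\<dots> = h {#} \<oplus> (\<Oplus>m\<in>(\<lambda>i. {#i#}) ` I. h m)"
    using I hB unfolding B_def by (intro finsum_insert) auto
  also have "(\<Oplus>m\<in>(\<lambda>i. {#i#}) ` I. h m) = (\<Oplus>i\<in>I. h {#i#})"
    using hB by (intro finsum_reindex) (auto simp: B_def inj_on_def)
  also have "\<dots> = (\<Oplus>i\<in>I. P {#i#} \<otimes> x i)"
    using x by (intro finsum_cong') (auto simp: h1)
  finally show ?thesis
    by (simp add: h0)
qed

text \<open>Along the line only coordinate \<open>i\<close> varies; the terms of the other variables
  form a constant \<open>s\<close>, which is absorbed into \<open>b\<close>.\<close>

lemma degree_family_1_on_line:
  assumes g: "g \<in> degree_family R n S 1" and S: "\<And>k. k \<in> {1..n} \<Longrightarrow> S k \<subseteq> carrier R"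
    and x: "x \<in> grid n S" and i: "i \<in> {1..n}"
  obtains b c where "b \<in> carrier R" "c \<in> carrier R"
    "\<And>v. v \<in> S i \<Longrightarrow> g (x(i := v)) = b \<oplus> c \<otimes> v"
proof -
  obtain P where P: "P \<in> indexed_pset {1..n} (carrier R)" "total_degree_le R P 1"
    and gP: "\<And>x. x \<in> grid n S \<Longrightarrow> g x = mpoly_eval R P x"
    using g by (auto simp: degree_family_def)
  have P_closed [simp]: "P m \<in> carrier R" for m
    using indexed_pset_in_carrier[OF subset_refl P(1)] by (rule carrier_coeffE)
  have x_closed: "x k \<in> carrier R" if "k \<in> {1..n}" for k
    using x S that by (auto simp: grid_def PiE_def Pi_def)
  define s where "s = (\<Oplus>k\<in>{1..n} - {i}. P {#k#} \<otimes> x k)"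
  have s [simp]: "s \<in> carrier R"
    unfolding s_def using x_closed by (intro finsum_closed) auto
  show ?thesis
  proof
    show "P {#} \<oplus> s \<in> carrier R" "P {#i#} \<in> carrier R"
      by simp_all
    fix v assume v: "v \<in> S i"
    with S i have [simp]: "v \<in> carrier R"
      by auto
    have "x(i := v) \<in> grid n S"
      using x v i by (auto simp: grid_def PiE_def Pi_def extensional_def)
    then have "g (x(i := v)) = mpoly_eval R P (x(i := v))"
      by (rule gP)
    also have "mpoly_eval R P (x(i := v)) = P {#} \<oplus> (\<Oplus>k\<in>{1..n}. P {#k#} \<otimes> (x(i := v)) k)"
      using x_closed by (intro mpoly_eval_degree_1 P) auto
    also have "(\<Oplus>k\<in>{1..n}. P {#k#} \<otimes> (x(i := v)) k)
        = (\<Oplus>k\<in>insert i ({1..n} - {i}). P {#k#} \<otimes> (x(i := v)) k)"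
      using i by (simp add: insert_absorb)
    also have "\<dots> = P {#i#} \<otimes> v \<oplus> (\<Oplus>k\<in>{1..n} - {i}. P {#k#} \<otimes> (x(i := v)) k)"
      using x_closed by (subst finsum_insert) auto
    also have "(\<Oplus>k\<in>{1..n} - {i}. P {#k#} \<otimes> (x(i := v)) k) = s"
      unfolding s_def using x_closed by (intro finsum_cong') auto
    finally show "g (x(i := v)) = P {#} \<oplus> s \<oplus> P {#i#} \<otimes> v"
      by (simp add: a_ac del: fun_upd_apply)
  qed
qed

text \<open>These are the members of the family that imitate an indicator at points where
  coordinates \<open>i\<close> and \<open>j\<close> have the same colour.\<close>

lemma scaled_difference_in_degree_family:
  assumes c: "c \<in> carrier R" and ij: "i \<in> {1..n}" "j \<in> {1..n}" "i \<noteq> j"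
    and S: "\<And>k. k \<in> {1..n} \<Longrightarrow> S k \<subseteq> carrier R"
  shows "(\<lambda>x\<in>grid n S. c \<otimes> (x i \<ominus> x j)) \<in> degree_family R n S 1"
proof -
  define P where "P = indexed_padd (indexed_pmult (indexed_const c) i)
    (indexed_pmult (indexed_const (\<ominus> c)) j)"
  have P: "P \<in> indexed_pset {1..n} (carrier R)"
    unfolding P_def using c ij by (intro indexed_pset.intros) auto
  have P0: "P {#} = \<zero>"
    by (simp add: P_def indexed_padd_def indexed_pmult_def)
  have P1: "P {#k#} = (if k = i then c else \<zero>) \<oplus> (if k = j then \<ominus> c else \<zero>)" for k
    by (simp add: P_def indexed_padd_def indexed_pmult_def indexed_const_def)
  have deg: "total_degree_le R P 1"
    unfolding total_degree_le_def
  proof (intro allI impI)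
    fix m assume "P m \<noteq> \<zero>"
    then have "(i \<in># m \<and> m - {#i#} = {#}) \<or> (j \<in># m \<and> m - {#j#} = {#})"
      by (auto simp: P_def indexed_padd_def indexed_pmult_def indexed_const_def split: if_splits)
    then show "size m \<le> 1"
      by (metis One_nat_def insert_DiffM le_refl size_single)
  qed
  have ev: "mpoly_eval R P x = c \<otimes> (x i \<ominus> x j)" if x: "x \<in> grid n S" for x
  proof -
    have x_closed: "x k \<in> carrier R" if "k \<in> {1..n}" for k
      using x S that by (auto simp: grid_def PiE_def Pi_def)
    have "mpoly_eval R P x = P {#} \<oplus> (\<Oplus>k\<in>{1..n}. P {#k#} \<otimes> x k)"
      using x_closed by (intro mpoly_eval_degree_1 P deg) auto
    \<comment> \<open>Splitting each coefficient into its \<open>i\<close> part and its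
      \<open>j\<close> part leaves two sums with a single surviving term each.\<close>
    also have "(\<Oplus>k\<in>{1..n}. P {#k#} \<otimes> x k)
        = (\<Oplus>k\<in>{1..n}. (if i = k then c \<otimes> x k else \<zero>) \<oplus> (if j = k then \<ominus> c \<otimes> x k else \<zero>))"
      using x_closed c ij by (intro finsum_cong') (auto simp: P1 simp del: l_minus)
    also have "\<dots> = (\<Oplus>k\<in>{1..n}. if i = k then c \<otimes> x k else \<zero>)
        \<oplus> (\<Oplus>k\<in>{1..n}. if j = k then \<ominus> c \<otimes> x k else \<zero>)"
      using x_closed c by (intro finsum_addf) auto
    also have "(\<Oplus>k\<in>{1..n}. if i = k then c \<otimes> x k else \<zero>) = c \<otimes> x i"
      using x_closed c ij by (intro finsum_singleton) auto
    also have "(\<Oplus>k\<in>{1..n}. if j = k then \<ominus> c \<otimes> x k else \<zero>) = \<ominus> c \<otimes> x j"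
      using x_closed c ij by (intro finsum_singleton) auto
    finally show ?thesis
      using x_closed[OF ij(1)] x_closed[OF ij(2)] c
      by (simp add: P0 r_distr a_minus_def l_minus r_minus)
  qed
  have "c \<otimes> (x i \<ominus> x j) \<in> carrier R" if "x \<in> grid n S" for x
  proof -
    have "x i \<in> S i" "x j \<in> S j"
      using that ij by (auto simp: grid_def PiE_def Pi_def)
    then show ?thesis
      using S[OF ij(1)] S[OF ij(2)] c by auto
  qed
  then show ?thesis
    unfolding degree_family_def using P deg ev by auto
qed

lemma degree_family_nonempty: "degree_family R n S d \<noteq> {}"
proof -
  have "mpoly_eval R (indexed_const \<zero>) x = \<zero>" for x
    by (simp add: mpoly_eval_def indexed_const_def)
  moreover have "indexed_const \<zero> \<in> indexed_pset {1..n} (carrier R)"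
    by (intro indexed_pset.indexed_const) simp
  moreover have "total_degree_le R (indexed_const \<zero>) d"
    by (simp add: total_degree_le_def indexed_const_def)
  ultimately have "(\<lambda>x\<in>grid n S. \<zero>) \<in> degree_family R n S d"
    unfolding degree_family_def by auto
  then show ?thesis
    by blast
qed

end

lemma degree_family_subset: "degree_family R n S d \<subseteq> grid n S \<rightarrow>\<^sub>E carrier R"
  by (auto simp: degree_family_def)

lemma finite_degree_family:
  assumes "finite (carrier R)" "finite (grid n S)"
  shows "finite (degree_family R n S d)"
  by (rule finite_subset[OF degree_family_subset]) (intro finite_PiE assms)

section \<open>The asymmetric grid\<close>

context field
begin

text \<open>An affine function \<open>b \<oplus> c \<otimes> v\<close> that vanishes at 0 and 1 has
  \<open>b\<close> and \<open>c\<close> zero, so it cannot take the value 1 at \<open>a i\<close>.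
  Hence each line in direction \<open>i\<close> contains a disagreement.\<close>

lemma card_grid_le_card_difference:
  assumes a: "a \<in> {1..n} \<rightarrow> carrier R" "a i \<noteq> \<zero>" "a i \<noteq> \<one>" and i: "i \<in> {1..n}"
    and S: "S = (\<lambda>i. {\<zero>, \<one>, a i})" and g: "g \<in> degree_family R n S 1"
    and f: "f = (\<lambda>x\<in>grid n S. if x i = a i then \<one> else \<zero>)"
  shows "card (grid n S) \<le> 3 * card {x \<in> grid n S. f x \<noteq> g x}"
proof -
  define B where "B = {x \<in> grid n S. f x \<noteq> g x}"
  have S_closed: "S k \<subseteq> carrier R" if "k \<in> {1..n}" for k
    using a that by (auto simp: S)
  have fin: "finite (grid n S)"
    by (auto simp: grid_def S intro!: finite_PiE)
  have upd: "x(i := v) \<in> grid n S" if "x \<in> grid n S" "v \<in> S i" for x v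
    using that i by (auto simp: grid_def PiE_def Pi_def extensional_def)
  have bad: "\<exists>v\<in>S i. x(i := v) \<in> B" if x: "x \<in> grid n S" for x
  proof (rule ccontr)
    assume "\<not> ?thesis"
    then have eq: "f (x(i := v)) = g (x(i := v))" if "v \<in> S i" for v
      using upd[OF x that] that by (auto simp: B_def)
    obtain b c where bc: "b \<in> carrier R" "c \<in> carrier R"
      and g_eq: "\<And>v. v \<in> S i \<Longrightarrow> g (x(i := v)) = b \<oplus> c \<otimes> v"
      using degree_family_1_on_line[OF g S_closed x i] by metis
    have f_eq: "b \<oplus> c \<otimes> v = (if v = a i then \<one> else \<zero>)" if "v \<in> S i" for v
      using g_eq[OF that] eq[OF that] upd[OF x that] by (simp add: f)
    have "b = \<zero>"
      using f_eq[of \<zero>] a bc by (auto simp: S)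
    moreover from this have "c = \<zero>"
      using f_eq[of \<one>] a bc by (auto simp: S)
    ultimately show False
      using f_eq[of "a i"] a i by (auto simp: S Pi_def)
  qed
  \<comment> \<open>Each grid point is recovered from a disagreement on its line by resetting
    coordinate \<open>i\<close>. The at most three choices of the new value give the factor
    3.\<close>
  have "grid n S \<subseteq> (\<lambda>(y, w). y(i := w)) ` (B \<times> S i)"
  proof
    fix x assume x: "x \<in> grid n S"
    obtain v where "v \<in> S i" "x(i := v) \<in> B"
      using bad[OF x] by blast
    moreover have "x i \<in> S i"
      using x i by (auto simp: grid_def PiE_def Pi_def)
    ultimately have "(\<lambda>(y, w). y(i := w)) (x(i := v), x i) \<in> (\<lambda>(y, w). y(i := w)) ` (B \<times> S i)"
      by blast
    then show "x \<in> (\<lambda>(y, w). y(i := w)) ` (B \<times> S i)"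
      by simp
  qed
  then have "card (grid n S) \<le> card (B \<times> S i)"
    using fin by (intro surj_card_le) (auto simp: B_def S)
  also have "\<dots> = card B * card (S i)"
    by (simp add: card_cartesian_product)
  also have "\<dots> \<le> card B * 3"
    by (intro mult_left_mono) (auto simp: S card_insert_if)
  finally show ?thesis
    by (simp add: B_def)
qed

text \<open>The total rejection probability of the \<open>f i\<close> is estimated twice: it is at
  least \<open>n / 6\<close>, half the distance 1/3 for each index, and at most the number of
  ternary words of length at most \<open>q\<close>.\<close>

lemma tester_query_bound:
  assumes fin: "finite (carrier R)"
    and a: "a \<in> {1..n} \<rightarrow> carrier R" "inj_on a {1..n}" "\<zero> \<notin> a ` {1..n}" "\<one> \<notin> a ` {1..n}"
    and S: "S = (\<lambda>i. {\<zero>, \<one>, a i})"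
    and q: "q_locally_testable q (grid n S) (carrier R) (degree_family R n S 1)"
  shows "n \<le> 6 * (\<Sum>k\<le>q. 3 ^ k)"
proof -
  let ?D = "grid n S" and ?F = "degree_family R n S 1"
  obtain M where M: "is_tester q ?D (carrier R) ?F M"
    using q by (auto simp: q_locally_testable_def)
  have S_closed: "S k \<subseteq> carrier R" if "k \<in> {1..n}" for k
    using a that by (auto simp: S)
  have D: "finite ?D" "?D \<noteq> {}"
    by (auto simp: grid_def S PiE_eq_empty_iff intro!: finite_PiE)
  have F: "finite ?F" "?F \<noteq> {}"
    using finite_degree_family[OF fin D(1)] degree_family_nonempty by auto
  define f where "f i = (\<lambda>x\<in>?D. if x i = a i then \<one> else \<zero>)" for i
  \<comment> \<open>Colour 2 stands for \<open>a i\<close>, a different field element in each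
    coordinate. The value of \<open>f i\<close> depends on the colour alone, through the same
    \<open>d\<close> for all \<open>i\<close>.\<close>
  define p where "p i x = (if x i = \<zero> then 0 else if x i = \<one> then 1 else 2 :: nat)"
    for i and x :: "nat \<Rightarrow> 'a"
  have f: "f i \<in> ?D \<rightarrow>\<^sub>E carrier R" for i
    by (auto simp: f_def)
  have x_cases: "x i \<in> {\<zero>, \<one>, a i}" if "x \<in> ?D" "i \<in> {1..n}" for x i
    using that by (auto simp: grid_def S PiE_def Pi_def)
  have a_neq: "a i \<noteq> \<zero>" "a i \<noteq> \<one>" "a i \<in> carrier R" if "i \<in> {1..n}" for i
    using a that by (force simp del: atLeastAtMost_iff)+
  have diff: "card ?D \<le> 3 * card {x \<in> ?D. f i x \<noteq> g x}" if "g \<in> ?F" "i \<in> {1..n}" for g i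
    using card_grid_le_card_difference[OF a(1) a_neq(1,2)[OF that(2)] that(2) S that(1) f_def] .
  \<comment> \<open>Taking \<open>g\<close> to be \<open>f i\<close> itself would make the nonempty
    grid have cardinality 0.\<close>
  have not_F: "f i \<notin> ?F" if "i \<in> {1..n}" for i
    using diff[of "f i" i] that D by auto
  have dist: "1 / 3 \<le> distance_to ?D ?F (f i)" if "i \<in> {1..n}" for i
    unfolding distance_to_def
  proof (rule Min.boundedI)
    fix y assume "y \<in> (\<lambda>g. real (card {x\<in>?D. f i x \<noteq> g x}) / real (card ?D)) ` ?F"
    then obtain g where "g \<in> ?F" and y: "y = real (card {x\<in>?D. f i x \<noteq> g x}) / real (card ?D)"
      by auto
    then have "real (card ?D) \<le> 3 * real (card {x \<in> ?D. f i x \<noteq> g x})"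
      using diff[OF _ that, of g] by linarith
    moreover have "0 < card ?D"
      using D by (simp add: card_gt_0_iff)
    ultimately show "1 / 3 \<le> y"
      unfolding y by (simp add: field_simps)
  qed (use F in auto)
  have rej: "1 / 6 \<le> measure M {T\<in>space M. \<not> accepts T (f i)}" if "i \<in> {1..n}" for i
  proof -
    have "distance_to ?D ?F (f i) / 2 \<le> measure M {T\<in>space M. \<not> accepts T (f i)}"
      using M f[of i] not_F[OF that] by (simp add: is_tester_def)
    with dist[OF that] show ?thesis
      by simp
  qed
  have "real n / 6 = (\<Sum>i\<in>{1..n}. 1 / 6)"
    by simp
  also have "\<dots> \<le> (\<Sum>i\<in>{1..n}. measure M {T\<in>space M. \<not> accepts T (f i)})"
    using rej by (intro sum_mono) auto
  also have "\<dots> \<le> real (\<Sum>k\<le>q. card {0, 1, 2 :: nat} ^ k)"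
  proof (rule sum_rejection_probability_le[where p = p and d = "\<lambda>k. if k = 2 then \<one> else \<zero>", OF M])
    show "p i x \<in> {0, 1, 2} \<and> f i x = (if p i x = 2 then \<one> else \<zero>)" if "i \<in> {1..n}" "x \<in> ?D" for i x
      using x_cases[OF that(2,1)] a_neq[OF that(1)] that(2) by (auto simp: p_def f_def)
    show "\<exists>g\<in>?F. \<forall>x\<in>?D. p i x = p j x \<longrightarrow> g x = f i x"
      if ij: "i \<in> {1..n}" "j \<in> {1..n}" "i \<noteq> j" for i j
    proof -
      let ?c = "inv (a i \<ominus> a j)"
      have "a i \<noteq> a j"
        using ij a(2) by (auto dest: inj_onD)
      then have "a i \<ominus> a j \<noteq> \<zero>"
        using a_neq ij by simp
      then have U: "a i \<ominus> a j \<in> Units R"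
        using a_neq(3)[OF ij(1)] a_neq(3)[OF ij(2)] by (simp add: field_Units)
      have cancel: "u \<ominus> u = \<zero>" if "u \<in> carrier R" for u
        using that by simp
      have "(\<lambda>x\<in>?D. ?c \<otimes> (x i \<ominus> x j)) \<in> ?F"
        using U ij S_closed by (intro scaled_difference_in_degree_family) auto
      \<comment> \<open>Equal colours 0 or 1 mean equal coordinates, so the difference is zero;
        colour 2 makes it \<open>a i \<ominus> a j\<close>, which the factor \<open>?c\<close> turns
        into 1.\<close>
      moreover have "?c \<otimes> (x i \<ominus> x j) = f i x" if x: "x \<in> ?D" "p i x = p j x" for x
        using x_cases[OF x(1) ij(1)] x_cases[OF x(1) ij(2)] x a_neq[OF ij(1)] a_neq[OF ij(2)] U
        by (auto simp: p_def f_def cancel split: if_splits)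
      ultimately show ?thesis
        by (intro bexI[of _ "\<lambda>x\<in>?D. ?c \<otimes> (x i \<ominus> x j)"]) auto
    qed
  qed (use F f in \<open>simp_all add: degree_family_subset del: One_nat_def\<close>)
  also have "card {0, 1, 2 :: nat} = 3"
    by simp
  finally have "real n \<le> real (6 * (\<Sum>k\<le>q. 3 ^ k))"
    by simp
  then show ?thesis
    by (simp only: of_nat_le_iff)
qed

end

section \<open>Instantiation over prime fields growing with the dimension\<close>

theorem theorem1p5:
  shows "\<exists>(F :: nat \<Rightarrow> int ring) (S :: nat \<Rightarrow> nat \<Rightarrow> int set).
    (\<forall>n. field (F n) \<and> (\<forall>i\<in>{1..n}. S n i \<subseteq> carrier (F n) \<and> card (S n i) = 3)) \<and>
    \<not> locally_testable (\<lambda>n. grid n (S n)) (\<lambda>n. carrier (F n))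
        (\<lambda>n. degree_family (F n) n (S n) 1) \<and>
    (\<lambda>n. real (query_complexity (grid n (S n)) (carrier (F n)) (degree_family (F n) n (S n) 1)))
      \<in> \<omega>(\<lambda>_. 1)"
proof -
  \<comment> \<open>The grid uses the integers from 0 to \<open>n + 1\<close>; a prime above
    \<open>n + 1\<close> makes them distinct residues.\<close>
  have "\<exists>p. prime p \<and> n + 1 < p" for n :: nat
    using bigger_prime by blast
  then obtain p :: "nat \<Rightarrow> nat" where p: "\<And>n. prime (p n)" "\<And>n. n + 1 < p n"
    by metis
  define F where "F n = residue_ring (int (p n))" for n
  \<comment> \<open>As indices start at 1, the third values run through 2 to \<open>n + 1\<close>:
    pairwise distinct and different from 0 and 1.\<close>
  define S where "S n = (\<lambda>i. {0, 1, int i + 1})" for n :: nat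
  let ?testable = "\<lambda>q n. q_locally_testable q (grid n (S n)) (carrier (F n)) (degree_family (F n) n (S n) 1)"
  let ?qc = "\<lambda>n. query_complexity (grid n (S n)) (carrier (F n)) (degree_family (F n) n (S n) 1)"
  have rp: "residues_prime (p n)" for n
    using p by unfold_locales
  have carrier: "carrier (F n) = {0..int (p n) - 1}" and zero: "\<zero>\<^bsub>F n\<^esub> = 0" and one: "\<one>\<^bsub>F n\<^esub> = 1" for n
    by (simp_all add: F_def residue_ring_def)
  have fld: "field (F n)" for n
    using residues_prime.is_field[OF rp] by (simp add: F_def)
  have S: "S n i \<subseteq> carrier (F n)" "card (S n i) = 3" if "i \<in> {1..n}" for n i
    using that p(2)[of n] by (auto simp: carrier S_def)
  have bound: "n \<le> 6 * (\<Sum>k\<le>q. 3 ^ k)" if "?testable q n" for q n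
  proof (rule field.tester_query_bound[OF fld, where a = "\<lambda>i. int i + 1"])
    show "(\<lambda>i. int i + 1) \<in> {1..n} \<rightarrow> carrier (F n)"
      using p(2)[of n] by (auto simp: carrier)
  qed (use that in \<open>auto simp: carrier zero one S_def inj_on_def\<close>)
  \<comment> \<open>With some tester at hand the \<open>LEAST\<close> is attained, so
    \<open>bound\<close> applies to the minimal number of queries.\<close>
  have "?testable (card (grid n (S n))) n" for n
  proof (rule q_locally_testable_card)
    show D: "finite (grid n (S n))" "grid n (S n) \<noteq> {}"
      by (auto simp: grid_def S_def PiE_eq_empty_iff intro!: finite_PiE)
    show "finite (degree_family (F n) n (S n) 1)"
      using D by (intro finite_degree_family) (simp_all add: carrier)
  qed (simp_all add: degree_family_subset cring.degree_family_nonempty fieldE(1)[OF fld])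
  then have qc: "?testable (?qc n) n" for n
    unfolding query_complexity_def by (rule LeastI)
  have "\<not> locally_testable (\<lambda>n. grid n (S n)) (\<lambda>n. carrier (F n)) (\<lambda>n. degree_family (F n) n (S n) 1)"
  proof
    assume "locally_testable (\<lambda>n. grid n (S n)) (\<lambda>n. carrier (F n)) (\<lambda>n. degree_family (F n) n (S n) 1)"
    then obtain q where "\<And>n. ?testable q n"
      by (auto simp: locally_testable_def)
    \<comment> \<open>The dimension is chosen one above the largest that \<open>q\<close> queries
      allow.\<close>
    from bound[OF this, of "Suc (6 * (\<Sum>k\<le>q. 3 ^ k))"] show False
      by simp
  qed
  moreover have "filterlim ?qc at_top at_top"
    unfolding filterlim_at_top
  proof
    fix q
    \<comment> \<open>The bound holds in each dimension and increases with \<open>q\<close>: beyond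
      the threshold for \<open>q\<close>, a complexity below \<open>q\<close> would contradict it.
      This gives divergence, not just unboundedness.\<close>
    show "\<forall>\<^sub>F n in at_top. q \<le> ?qc n"
      using eventually_gt_at_top[of "6 * (\<Sum>k\<le>q. 3 ^ k)"]
    proof eventually_elim
      case (elim n)
      show ?case
      proof (rule ccontr)
        assume "\<not> q \<le> ?qc n"
        then have "(\<Sum>k\<le>?qc n. 3 ^ k) \<le> (\<Sum>k\<le>q. 3 ^ k :: nat)"
          by (intro sum_mono2) auto
        with bound[OF qc[of n]] elim show False
          by linarith
      qed
    qed
  qed
  then have "(\<lambda>n. real (?qc n)) \<in> \<omega>(\<lambda>_. 1)"
    unfolding smallomega_1_conv_filterlim
    by (intro filterlim_at_top_imp_at_infinity filterlim_compose[OF filterlim_real_sequentially])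
  ultimately show ?thesis
    using fld S by blast
qed

end
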